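(* For every $n\ge1$ and $r\ge2$, both ideals $I_{((1,\dots,1),0)}$ and $I_{((n),0)}$ of $K[x_1,\dots,x_n]$ are radical, where $(1,\dots,1)$ and $(n)$ are the partitions of $n$ with all parts equal to $1$ and with a single part, respectively.
   Context: Standing assumptions: $K$ is an infinite field containing all $r$-th roots of unity (e.g. algebraically closed), with $\mu_r\subset K^\times$ the group of $r$-th roots of unity; $\mu_r$ is identified with $\mathbb{Z}/r\mathbb{Z}$ (through $G(r,1,n)=(\mathbb{Z}/r\mathbb{Z})\wr S_n=\{(\eta_1,\dots,\eta_n;\sigma):\eta_i\in\mu_r,\ \sigma\in S_n\}$), so $\mu_r$ has exactly $r$ elements. Classical Specht ideal: for a partition $\mu\vdash N$, $I_\mu\subset K[y_1,\dots,y_N]$ is the ideal generated by the Specht polynomials of all tableaux $T$ of shape $\mu$ (bijective fillings with $1,\dots,N$); the Specht polynomial of $T$ is the product over the columns of $T$ of the Vandermonde products $\prod(y_a-y_b)$ over pairs of entries $a,b$ in that column (one factor for each pair; empty products equal $1$). Definition of $I_{(\mu,z)}$: let $0\le z\le n$ and $\mu\vdash n-z$. For $S=\{i_1<\dots<i_{n-z}\}\subset\{1,\dots,n\}$, let $\phi_S:K[y_1,\dots,y_{n-z}]\to K[x_{i_1},\dots,x_{i_{n-z}}]$ be the $K$-algebra homomorphism $y_j\mapsto x_{i_j}^r$, and let $X_S=(x_j:j\notin S)\subset K[x_1,\dots,x_n]$. Let $I_{\ge z+1}$ be the ideal of $K[x_1,\dots,x_n]$ generated by all squarefree monomials of degree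 $n-z$. Then $$I_{(\mu,z)}:=\Big[\bigcap_{S\subset\{1,\dots,n\},\,|S|=n-z}\big(X_S+\phi_S(I_\mu)\big)\Big]\cap I_{\ge z+1},$$ where $X_S+\phi_S(I_\mu)$ denotes the ideal of $K[x_1,\dots,x_n]$ generated by $X_S$ and $\phi_S(I_\mu)$. *)

theory Defs
  imports Complex_Main "HOL-Algebra.Ideal" "HOL-Library.Poly_Mapping"
begin

text \<open>Monomials are finitely supported exponent functions on variables indexed by
  \<^typ>\<open>nat\<close>. The ring \<open>K[x\<^sub>1,\<dots>,x\<^sub>n]\<close> is the subring of polynomials in which only
  the variables with index in \<open>{1..n}\<close> occur.\<close>

type_synonym 'a mpoly = "(nat \<Rightarrow>\<^sub>0 nat) \<Rightarrow>\<^sub>0 'a"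

definition Const :: "'a::comm_ring_1 \<Rightarrow> 'a mpoly"
  where "Const c = Poly_Mapping.single 0 c"

definition Var :: "nat \<Rightarrow> 'a::comm_ring_1 mpoly"
  where "Var i = Poly_Mapping.single (Poly_Mapping.single i 1) 1"

definition vars :: "'a::comm_ring_1 mpoly \<Rightarrow> nat set"
  where "vars p = (\<Union>m\<in>Poly_Mapping.keys p. Poly_Mapping.keys m)"

definition polyring :: "nat \<Rightarrow> 'a::comm_ring_1 mpoly ring"
  where "polyring n =
    \<lparr>carrier = {p. vars p \<subseteq> {1..n}}, mult = (*), one = 1, zero = 0, add = (+)\<rparr>"

definition msubst :: "(nat \<Rightarrow> 'a mpoly) \<Rightarrow> (nat \<Rightarrow>\<^sub>0 nat) \<Rightarrow> 'a::comm_ring_1 mpoly"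
  where "msubst f m = (\<Prod>j\<in>Poly_Mapping.keys m. f j ^ Poly_Mapping.lookup m j)"

text \<open>The \<open>K\<close>-algebra homomorphism sending the \<open>j\<close>-th variable to \<open>f j\<close>.\<close>

definition subst :: "(nat \<Rightarrow> 'a mpoly) \<Rightarrow> 'a::comm_ring_1 mpoly \<Rightarrow> 'a mpoly"
  where "subst f p =
    (\<Sum>m\<in>Poly_Mapping.keys p. Const (Poly_Mapping.lookup p m) * msubst f m)"

definition radical :: "('a, 'b) ring_scheme \<Rightarrow> 'a set \<Rightarrow> 'a set"
  where "radical R I = {a \<in> carrier R. \<exists>k::nat. a [^]\<^bsub>R\<^esub> k \<in> I}"

definition radical_ideal :: "'a set \<Rightarrow> ('a, 'b) ring_scheme \<Rightarrow> bool"
  where "radical_ideal I R \<longleftrightarrow> ideal I R \<and> radical R I = I"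

text \<open>A partition is the weakly decreasing list of its (positive) parts. Cells are pairs
  (row, column), both counted from 0.\<close>

definition is_partition :: "nat list \<Rightarrow> nat \<Rightarrow> bool"
  where "is_partition \<mu> N \<longleftrightarrow> sorted_wrt (\<ge>) \<mu> \<and> (\<forall>a\<in>set \<mu>. 0 < a) \<and> sum_list \<mu> = N"

definition cells :: "nat list \<Rightarrow> (nat \<times> nat) set"
  where "cells \<mu> = {(i, j). i < length \<mu> \<and> j < \<mu> ! i}"

definition tableaux :: "nat list \<Rightarrow> (nat \<times> nat \<Rightarrow> nat) set"
  where "tableaux \<mu> = {T. bij_betw T (cells \<mu>) {1..sum_list \<mu>}}"

text \<open>The first product runs over the columns; each unordered pair of entries of a column
  contributes one factor, the entry in the higher row coming first.\<close>

definition specht_poly :: "nat list \<Rightarrow> (nat \<times> nat \<Rightarrow> nat) \<Rightarrow> 'a::comm_ring_1 mpoly"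
  where "specht_poly \<mu> T =
    (\<Prod>j\<in>snd ` cells \<mu>.
       \<Prod>(i, i')\<in>{(i, i'). i < i' \<and> (i, j) \<in> cells \<mu> \<and> (i', j) \<in> cells \<mu>}.
         Var (T (i, j)) - Var (T (i', j)))"

definition specht_ideal :: "nat list \<Rightarrow> 'a::comm_ring_1 mpoly set"
  where "specht_ideal \<mu> = Idl\<^bsub>polyring (sum_list \<mu>)\<^esub> (specht_poly \<mu> ` tableaux \<mu>)"

text \<open>For \<open>S = {i\<^sub>1 < \<dots> < i\<^sub>k}\<close>, the list \<open>sorted_list_of_set S\<close> is indexed from 0, so that
  \<open>i\<^sub>j\<close> is its entry at position \<open>j - 1\<close>.\<close>

definition phi :: "nat \<Rightarrow> nat set \<Rightarrow> 'a::comm_ring_1 mpoly \<Rightarrow> 'a mpoly"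
  where "phi r S = subst (\<lambda>j. Var (sorted_list_of_set S ! (j - 1)) ^ r)"

text \<open>The ideal \<open>I\<^bsub>\<ge>z+1\<^esub>\<close>.\<close>

definition sqfree_ideal :: "nat \<Rightarrow> nat \<Rightarrow> 'a::comm_ring_1 mpoly set"
  where "sqfree_ideal n z =
    Idl\<^bsub>polyring n\<^esub> {\<Prod>i\<in>A. Var i | A. A \<subseteq> {1..n} \<and> card A = n - z}"

text \<open>The ideal \<open>I\<^bsub>(\<mu>,z)\<^esub>\<close> of \<open>K[x\<^sub>1,\<dots>,x\<^sub>n]\<close>, meant for \<open>z \<le> n\<close> and \<open>\<mu>\<close> a partition of \<open>n - z\<close>.\<close>

definition gspecht_ideal :: "nat \<Rightarrow> nat \<Rightarrow> nat list \<Rightarrow> nat \<Rightarrow> 'a::comm_ring_1 mpoly set"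
  where "gspecht_ideal r n \<mu> z =
    (\<Inter>S\<in>{S. S \<subseteq> {1..n} \<and> card S = n - z}.
       Idl\<^bsub>polyring n\<^esub> (Var ` ({1..n} - S) \<union> phi r S ` specht_ideal \<mu>))
    \<inter> sqfree_ideal n z"


subsection \<open>Basic facts\<close>

lemma is_partition_ones: "is_partition (replicate n 1) n"
  by (auto simp: is_partition_def sorted_wrt_iff_nth_less sum_list_replicate)

lemma is_partition_single: "n \<ge> 1 \<Longrightarrow> is_partition [n] n"
  by (auto simp: is_partition_def)

lemma vars_add: "vars (p + q) \<subseteq> vars p \<union> vars q"
  using Poly_Mapping.keys_add[of p q] by (auto simp: vars_def)

lemma vars_mult: "vars (p * q) \<subseteq> vars p \<union> vars q"
proof
  fix i assume "i \<in> vars (p * q)"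
  then obtain m where m: "m \<in> Poly_Mapping.keys (p * q)" "i \<in> Poly_Mapping.keys m"
    by (auto simp: vars_def)
  from m(1) obtain a b where ab: "a \<in> Poly_Mapping.keys p" "b \<in> Poly_Mapping.keys q" "m = a + b"
    using keys_mult[of p q] by blast
  then have "i \<in> Poly_Mapping.keys a \<union> Poly_Mapping.keys b"
    using m(2) Poly_Mapping.keys_add[of a b] by blast
  then show "i \<in> vars p \<union> vars q"
    using ab by (auto simp: vars_def)
qed

lemma vars_uminus: "vars (- p) = vars p"
  by (simp add: vars_def in_keys_iff set_eq_iff)

lemma cring_polyring: "cring (polyring n :: 'a::comm_ring_1 mpoly ring)"
proof (rule cringI)
  show "abelian_group (polyring n :: 'a mpoly ring)"
  proof (rule abelian_groupI)
    fix x :: "'a mpoly"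
    assume "x \<in> carrier (polyring n)"
    then show "\<exists>y\<in>carrier (polyring n). y \<oplus>\<^bsub>polyring n\<^esub> x = \<zero>\<^bsub>polyring n\<^esub>"
      by (intro bexI[of _ "- x"]) (auto simp: polyring_def vars_uminus)
  qed (use vars_add in \<open>fastforce simp: polyring_def vars_def algebra_simps\<close>)+
  show "Group.comm_monoid (polyring n :: 'a mpoly ring)"
    by (rule comm_monoidI)
       (use vars_mult in \<open>fastforce simp: polyring_def vars_def algebra_simps\<close>)+
qed (auto simp: polyring_def algebra_simps)

lemma msubst_superset:
  "finite A \<Longrightarrow> Poly_Mapping.keys m \<subseteq> A \<Longrightarrow>
    msubst f m = (\<Prod>j\<in>A. f j ^ Poly_Mapping.lookup m j)"
  unfolding msubst_def by (rule prod.mono_neutral_left) (auto simp: in_keys_iff)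

lemma msubst_add: "msubst f (m + m') = msubst f m * msubst f m'"
proof -
  let ?A = "Poly_Mapping.keys m \<union> Poly_Mapping.keys m'"
  have "msubst f (m + m') = (\<Prod>j\<in>?A. f j ^ Poly_Mapping.lookup (m + m') j)"
    by (rule msubst_superset) (use Poly_Mapping.keys_add[of m m'] in auto)
  also have "\<dots> = msubst f m * msubst f m'"
    by (simp add: msubst_superset[of ?A m] msubst_superset[of ?A m']
        lookup_add power_add prod.distrib)
  finally show ?thesis .
qed

lemma Const_0 [simp]: "Const 0 = 0" and Const_1 [simp]: "Const 1 = 1"
  and Const_add: "Const (a + b) = Const a + Const b"
  and Const_mult: "Const (a * b) = Const a * Const b"
  by (simp_all add: Const_def single_add mult_single)

lemma subst_superset:
  "finite A \<Longrightarrow> Poly_Mapping.keys p \<subseteq> A \<Longrightarrow>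
    subst f p = (\<Sum>m\<in>A. Const (Poly_Mapping.lookup p m) * msubst f m)"
  unfolding subst_def by (rule sum.mono_neutral_left) (auto simp: in_keys_iff)

lemma subst_single: "subst f (Poly_Mapping.single m c) = Const c * msubst f m"
  by (subst subst_superset[of "{m}"]) auto

lemma subst_0 [simp]: "subst f 0 = 0"
  by (simp add: subst_def)

lemma subst_Const: "subst f (Const c) = Const c"
  by (simp add: Const_def[of c] subst_single) (simp add: Const_def msubst_def)

lemma subst_1 [simp]: "subst f 1 = 1"
  using subst_Const[of f 1] by simp

lemma subst_Var: "subst f (Var i) = f i"
  by (simp add: Var_def subst_single msubst_def)

lemma subst_add: "subst f (p + q) = subst f p + subst f q"
proof -
  let ?A = "Poly_Mapping.keys p \<union> Poly_Mapping.keys q"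
  have "subst f (p + q) = (\<Sum>m\<in>?A. Const (Poly_Mapping.lookup (p + q) m) * msubst f m)"
    by (rule subst_superset) (use Poly_Mapping.keys_add[of p q] in auto)
  also have "\<dots> = subst f p + subst f q"
    by (simp add: subst_superset[of ?A p] subst_superset[of ?A q]
        lookup_add Const_add distrib_right sum.distrib)
  finally show ?thesis .
qed

lemma mpoly_add_single_induct:
  fixes p :: "'a::comm_ring_1 mpoly"
  assumes "P 0" and "\<And>q m c. P q \<Longrightarrow> P (Poly_Mapping.single m c + q)"
  shows "P p"
proof -
  have "P (\<Sum>m\<in>A. Poly_Mapping.single m (Poly_Mapping.lookup p m))" if "finite A" for A
    using that by (induction A) (auto intro: assms)
  moreover have "(\<Sum>m\<in>Poly_Mapping.keys p. Poly_Mapping.single m (Poly_Mapping.lookup p m)) = p"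
    by (rule poly_mapping_eqI)
       (auto simp: lookup_sum lookup_single when_def in_keys_iff sum.delta)
  ultimately show ?thesis
    by (metis finite_keys)
qed

lemma subst_mult: "subst f (p * q) = subst f p * subst f q"
proof (induction p rule: mpoly_add_single_induct)
  case (2 p m c)
  have "subst f (Poly_Mapping.single m c * q) = subst f (Poly_Mapping.single m c) * subst f q"
    by (induction q rule: mpoly_add_single_induct)
       (simp_all add: distrib_left subst_add mult_single subst_single msubst_add Const_mult mult_ac)
  with 2 show ?case
    by (simp add: distrib_right subst_add)
qed simp

end

theory Submission
  imports Defs "HOL-Computational_Algebra.Polynomial"
begin

text \<open>For \<open>z = 0\<close> only \<open>S = {1..n}\<close> occurs, so both ideals are intersections of principal ideals.
  The squarefree ideal is generated by \<open>x\<^sub>1 \<cdots> x\<^sub>n\<close>; the Specht part is the unit ideal for the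
  partition \<open>(n)\<close>, and for \<open>(1,\<dots>,1)\<close> it is generated by the product of all \<open>x\<^sub>a\<^sup>r - x\<^sub>b\<^sup>r\<close>
  with \<open>a < b\<close>, which factors into the linear forms \<open>x\<^sub>a - \<zeta> x\<^sub>b\<close> with \<open>\<zeta>\<^sup>r = 1\<close>. All these
  generators are products of pairwise non-associated primes. A linear form \<open>x\<^sub>a - c x\<^sub>b\<close> is prime
  because it generates the kernel of the substitution \<open>x\<^sub>a \<mapsto> c x\<^sub>b\<close>.\<close>

section \<open>Products of primes, and the factorization of \<open>x ^ r - y ^ r\<close>\<close>

lemma prime_elem_dvd_prod:
  fixes p :: "'a::comm_semiring_1"
  assumes "prime_elem p" and "p dvd prod f A"
  shows "\<exists>a\<in>A. p dvd f a"
  using assms(2)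
  by (induction A rule: infinite_finite_induct)
     (use assms(1) in \<open>auto dest: prime_elem_dvd_multD prime_elem_not_unit\<close>)

text \<open>Induction over the factors: once \<open>f = prod L A * g\<close>, a further prime
  \<open>L a\<close> divides \<open>f\<close> but none of the earlier factors, hence not their
  product, so it must divide \<open>g\<close>.\<close>

lemma prod_prime_elem_dvd:
  fixes L :: "'b \<Rightarrow> 'a::comm_semiring_1"
  assumes "finite A" and "\<And>a. a \<in> A \<Longrightarrow> prime_elem (L a)"
    and "\<And>a b. a \<in> A \<Longrightarrow> b \<in> A \<Longrightarrow> a \<noteq> b \<Longrightarrow> \<not> L a dvd L b"
    and "\<And>a. a \<in> A \<Longrightarrow> L a dvd f"
  shows "prod L A dvd f"
  using assms
proof (induction A)
  case (insert a A)
  then obtain g where g: "f = prod L A * g"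
    by (metis dvdE insertI2)
  have "prime_elem (L a)" "L a dvd prod L A * g"
    using insert.prems g by auto
  moreover have "\<not> L a dvd prod L A"
    using insert.prems insert.hyps prime_elem_dvd_prod[of "L a" L A] by (metis insertCI)
  ultimately have "L a dvd g"
    using prime_elem_dvd_multD by blast
  then show ?case
    using insert.hyps g by (simp add: mult.commute mult_dvd_mono)
qed simp

text \<open>This is the source of radicality: each prime factor of the product that divides
  \<open>f ^ k\<close> already divides \<open>f\<close>, and the primes then recombine.\<close>

lemma prod_prime_elem_dvd_power:
  fixes L :: "'b \<Rightarrow> 'a::comm_semiring_1"
  assumes "finite A" and "\<And>a. a \<in> A \<Longrightarrow> prime_elem (L a)"
    and "\<And>a b. a \<in> A \<Longrightarrow> b \<in> A \<Longrightarrow> a \<noteq> b \<Longrightarrow> \<not> L a dvd L b"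
    and "prod L A dvd f ^ k"
  shows "prod L A dvd f"
proof (rule prod_prime_elem_dvd)
  fix a assume "a \<in> A"
  then show "L a dvd f"
    using assms by (meson dvd_prodI dvd_trans prime_elem_dvd_power)
qed (use assms in auto)

text \<open>For fixed nonzero \<open>y\<close>, both sides are monic of degree \<open>r\<close> in
  \<open>x\<close> and vanish at the \<open>r\<close> points \<open>\<zeta> * y\<close>, which
  determines them. For \<open>y = 0\<close> these points coincide, so that case is separate. The
  domain is left general so that \<open>x\<close> and \<open>y\<close> may themselves be
  polynomials.\<close>

lemma prod_linear_roots_of_unity:
  fixes x y :: "'a::idom"
  assumes "finite Z" and "card Z = r" and "r > 0" and "\<And>\<zeta>. \<zeta> \<in> Z \<Longrightarrow> \<zeta> ^ r = 1"
  shows "(\<Prod>\<zeta>\<in>Z. x - \<zeta> * y) = x ^ r - y ^ r"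
proof (cases "y = 0")
  case True
  then show ?thesis
    using assms by (simp add: zero_power)
next
  case False
  let ?p = "monom 1 r - [:y ^ r:]" and ?q = "\<Prod>\<zeta>\<in>Z. [:- (\<zeta> * y), 1:]"
  have degq: "degree ?q = r"
    using assms by (subst degree_prod_eq_sum_degree) auto
  have "lead_coeff ?q = 1"
    by (simp add: lead_coeff_prod)
  have "?p = ?q"
  proof (rule poly_eqI_degree_lead_coeff[where n = r and A = "(\<lambda>\<zeta>. \<zeta> * y) ` Z"])
    show "card ((\<lambda>\<zeta>. \<zeta> * y) ` Z) \<ge> r"
      using assms False by (subst card_image) (auto simp: inj_on_def)
    show "coeff ?p r = coeff ?q r"
      using degq \<open>lead_coeff ?q = 1\<close> assms(3) by (simp add: coeff_pCons split: nat.split)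
    show "degree ?p \<le> r"
      by (rule degree_diff_le) (auto simp: degree_monom_le)
    show "degree ?q \<le> r"
      using degq by simp
    fix z assume "z \<in> (\<lambda>\<zeta>. \<zeta> * y) ` Z"
    then obtain \<zeta> where "\<zeta> \<in> Z" "z = \<zeta> * y"
      by auto
    then show "poly ?p z = poly ?q z"
      using assms by (auto simp: poly_monom power_mult_distrib poly_prod prod_zero_iff)
  qed
  then have "poly ?p x = poly ?q x"
    by simp
  then show ?thesis
    by (simp add: poly_monom poly_prod)
qed

section \<open>Substitutions, their variables, and congruences between them\<close>

lemma subst_diff: "subst f (p - q) = subst f p - subst f q"
  using subst_add[of f "p - q" q] by (simp add: algebra_simps)

lemma subst_power: "subst f (p ^ k) = subst f p ^ k"
  by (induction k) (simp_all add: subst_mult)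

lemma subst_prod: "subst f (\<Prod>a\<in>A. g a) = (\<Prod>a\<in>A. subst f (g a))"
  by (induction A rule: infinite_finite_induct) (simp_all add: subst_mult)

lemma subst_dvd: "p dvd q \<Longrightarrow> subst f p dvd subst f q"
  by (auto simp: subst_mult elim!: dvdE)

lemma Const_power: "Const (c ^ k) = Const c ^ k"
  by (induction k) (simp_all add: Const_mult)

lemma vars_0 [simp]: "vars 0 = {}" and vars_1 [simp]: "vars 1 = {}"
  and vars_Const [simp]: "vars (Const c) = {}"
  by (auto simp: vars_def Const_def)

lemma vars_Var: "vars (Var i :: 'a::comm_ring_1 mpoly) = {i}"
  by (simp add: vars_def Var_def)

lemma vars_diff: "vars (p - q) \<subseteq> vars p \<union> vars q"
  using vars_add[of p "- q"] by (simp add: vars_uminus)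

lemma vars_power: "vars (p ^ k) \<subseteq> vars p"
proof (induction k)
  case (Suc k)
  then show ?case
    using vars_mult[of p "p ^ k"] by auto
qed simp

lemma vars_prod: "vars (\<Prod>a\<in>A. g a) \<subseteq> (\<Union>a\<in>A. vars (g a))"
proof (induction A rule: infinite_finite_induct)
  case (insert a A)
  then show ?case
    using vars_mult[of "g a" "prod g A"] by auto
qed simp_all

lemma vars_sum: "vars (\<Sum>a\<in>A. g a) \<subseteq> (\<Union>a\<in>A. vars (g a))"
proof (induction A rule: infinite_finite_induct)
  case (insert a A)
  then show ?case
    using vars_add[of "g a" "sum g A"] by auto
qed simp_all

lemma vars_subst: "vars (subst f p) \<subseteq> (\<Union>i\<in>vars p. vars (f i))"
proof -
  have "vars (Const (Poly_Mapping.lookup p m) * msubst f m) \<subseteq> (\<Union>i\<in>vars p. vars (f i))"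
    if "m \<in> Poly_Mapping.keys p" for m
  proof -
    have "vars (msubst f m) \<subseteq>
        (\<Union>i\<in>Poly_Mapping.keys m. vars (f i ^ Poly_Mapping.lookup m i))"
      unfolding msubst_def by (rule vars_prod)
    also have "\<dots> \<subseteq> (\<Union>i\<in>Poly_Mapping.keys m. vars (f i))"
      by (intro UN_mono vars_power) simp
    also have "\<dots> \<subseteq> (\<Union>i\<in>vars p. vars (f i))"
      using that by (auto simp: vars_def[of p])
    finally show ?thesis
      using vars_mult[of "Const (Poly_Mapping.lookup p m)" "msubst f m"] by auto
  qed
  then show ?thesis
    unfolding subst_def by (intro order_trans[OF vars_sum] UN_least)
qed

lemma dvd_diff_power:
  fixes d :: "'a::comm_ring_1"
  shows "d dvd x - y \<Longrightarrow> d dvd x ^ k - y ^ k"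
  by (metis dvd_mult2 power_diff_sumr2)

lemma dvd_diff_prod:
  fixes d :: "'a::comm_ring_1"
  assumes "\<And>a. a \<in> A \<Longrightarrow> d dvd f a - g a"
  shows "d dvd prod f A - prod g A"
  using assms
proof (induction A rule: infinite_finite_induct)
  case (insert a A)
  have "prod f (insert a A) - prod g (insert a A) =
      f a * (prod f A - prod g A) + (f a - g a) * prod g A"
    using insert.hyps by (simp add: algebra_simps)
  then show ?case
    using insert by (simp add: dvd_add)
qed simp_all

lemma msubst_Var: "msubst Var m = (Poly_Mapping.single m 1 :: 'a::comm_ring_1 mpoly)"
proof (induction m rule: update_induct)
  case (update m k v)
  have "(Var k :: 'a mpoly) ^ v = Poly_Mapping.single (Poly_Mapping.single k v) 1"
    by (induction v) (simp_all add: Var_def mult_single flip: single_add)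
  then have "msubst Var (Poly_Mapping.single k v) =
      (Poly_Mapping.single (Poly_Mapping.single k v) 1 :: 'a mpoly)"
    using update.hyps by (simp add: msubst_def)
  \<comment> \<open>The new variable \<open>k\<close> does not occur in \<open>m\<close>, so
    overwriting its exponent is the same as adding \<open>v\<close> to it.\<close>
  moreover have "Poly_Mapping.update k v m = Poly_Mapping.single k v + m"
    using update.hyps
    by (intro poly_mapping_eqI)
       (auto simp: lookup_update lookup_add lookup_single in_keys_iff when_def)
  ultimately show ?case
    using update.IH by (simp add: msubst_add mult_single)
qed (simp add: msubst_def)

lemma subst_Var_id: "subst Var p = p"
  by (induction p rule: mpoly_add_single_induct)
     (simp_all add: subst_add subst_single msubst_Var Const_def mult_single)

text \<open>Reading \<open>d dvd x - y\<close> as congruence modulo \<open>d\<close>, powers and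
  products preserve it, hence so does every monomial. With \<open>g = Var\<close> and
  \<open>subst_Var_id\<close> this compares \<open>p\<close> itself with its image under
  \<open>f\<close>.\<close>

lemma dvd_diff_subst:
  fixes p d :: "'a::comm_ring_1 mpoly"
  assumes "\<And>i. i \<in> vars p \<Longrightarrow> d dvd g i - f i"
  shows "d dvd subst g p - subst f p"
proof -
  have "d dvd Const (Poly_Mapping.lookup p m) * (msubst g m - msubst f m)"
    if "m \<in> Poly_Mapping.keys p" for m
    unfolding msubst_def using assms that
    by (intro dvd_mult dvd_diff_prod dvd_diff_power) (auto simp: vars_def)
  then show ?thesis
    unfolding subst_def sum_subtractf[symmetric] right_diff_distrib[symmetric]
    by (rule dvd_sum)
qed

lemma subst_eq_self:
  assumes "\<And>i. i \<in> vars p \<Longrightarrow> f i = Var i"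
  shows "subst f p = p"
  \<comment> \<open>Congruence modulo 0 is equality.\<close>
  using dvd_diff_subst[of p 0 Var f] assms by (simp add: subst_Var_id)

section \<open>Linear forms in two variables as primes\<close>

lemma Const_mult_Var_eq_iff:
  "Const c * Var i = Const d * Var j \<longleftrightarrow> c = d \<and> (c = 0 \<or> i = j)"
proof -
  have "Const c * Var i = Poly_Mapping.single (Poly_Mapping.single i 1) c" for c :: 'a and i
    by (simp add: Const_def Var_def mult_single)
  moreover have "Poly_Mapping.single i (1::nat) = Poly_Mapping.single j 1 \<longleftrightarrow> i = j"
    by (metis lookup_single_eq lookup_single_not_eq zero_neq_one)
  ultimately show ?thesis
    by (metis lookup_single_eq lookup_single_not_eq single_zero)
qed

text \<open>The substitution fixes \<open>Var j\<close> because \<open>i \<noteq> j\<close>, so it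
  kills the linear form and all its multiples. Conversely, it differs from the identity only at
  \<open>i\<close>, and there by exactly the linear form, so \<open>p\<close> is congruent to its
  image modulo that form.\<close>

lemma linear_dvd_iff:
  fixes c :: "'a::comm_ring_1"
  assumes "i \<noteq> j"
  shows "Var i - Const c * Var j dvd p \<longleftrightarrow> subst (Var(i := Const c * Var j)) p = 0"
    (is "?d dvd p \<longleftrightarrow> subst ?f p = 0")
proof
  assume "?d dvd p"
  then have "subst ?f ?d dvd subst ?f p"
    by (rule subst_dvd)
  then show "subst ?f p = 0"
    using assms by (simp add: subst_diff subst_mult subst_Var subst_Const)
next
  assume "subst ?f p = 0"
  then show "?d dvd p"
    using dvd_diff_subst[of p ?d Var ?f] by (simp add: subst_Var_id)
qed

lemma prime_elem_linear:
  fixes c :: "'a::idom"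
  assumes "i \<noteq> j"
  shows "prime_elem (Var i - Const c * Var j)"
proof (rule prime_elemI)
  show "Var i - Const c * Var j \<noteq> 0"
    using assms Const_mult_Var_eq_iff[of 1 i c j] by auto
\<comment> \<open>Under \<open>linear_dvd_iff\<close>, being a non-unit becomes
  \<open>1 \<noteq> 0\<close>, and primality becomes the absence of zero divisors.\<close>
qed (simp_all add: assms linear_dvd_iff subst_mult)

text \<open>Ordering the indices excludes associates of the kind \<open>x_b - c^(-1) x_a\<close>,
  and \<open>c \<noteq> 0\<close> is what makes the form remember its second index
  \<open>j\<close>.\<close>

lemma linear_dvd_linear:
  fixes c c' :: "'a::idom"
  assumes "i < j" and "k < l" and "c \<noteq> 0" and "Var i - Const c * Var j dvd Var k - Const c' * Var l"
  shows "(i, j, c) = (k, l, c')"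
proof -
  let ?f = "Var(i := Const c * Var j)"
  have eq: "?f k = Const c' * ?f l"
    using assms by (simp add: linear_dvd_iff subst_diff subst_mult subst_Var subst_Const
        del: fun_upd_apply)
  \<comment> \<open>The three instances cover \<open>k = i\<close>, neither index equal to
    \<open>i\<close>, and \<open>l = i\<close>. Only the first is consistent: the second would need
    \<open>k = l\<close>, and in the third \<open>k < i < j\<close>.\<close>
  show ?thesis
    using eq assms(1,2,3) Const_mult_Var_eq_iff[of c j c' l] Const_mult_Var_eq_iff[of 1 k c' l]
      Const_mult_Var_eq_iff[of 1 k "c' * c" j]
    by (auto simp: Const_mult mult.assoc split: if_splits)
qed

text \<open>A variable is a linear form with coefficient 0; \<open>Suc i\<close> merely supplies an
  index different from \<open>i\<close>.\<close>

lemma Var_dvd_Var: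
  assumes "Var i dvd (Var k :: 'a::idom mpoly)"
  shows "i = k"
  using assms linear_dvd_iff[of i "Suc i" 0 "Var k :: 'a mpoly"]
    Const_mult_Var_eq_iff[of "1::'a" k 0 k]
  by (simp add: subst_Var split: if_splits)

lemma prime_elem_Var: "prime_elem (Var i :: 'a::idom mpoly)"
  using prime_elem_linear[of i "Suc i" 0] by simp

section \<open>Principal ideals of \<open>polyring n\<close>\<close>

lemma pow_polyring: "a [^]\<^bsub>polyring n\<^esub> (k::nat) = a ^ k"
  by (induction k) (simp_all add: nat_pow_def polyring_def mult.commute)

text \<open>The retraction \<open>x\<^sub>i \<mapsto> 0\<close> for \<open>i > n\<close> brings a quotient back into \<open>K[x\<^sub>1,\<dots>,x\<^sub>n]\<close>.\<close>

lemma dvd_polyringE: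
  assumes "p \<in> carrier (polyring n)" and "q \<in> carrier (polyring n)" and "q dvd p"
  obtains h where "h \<in> carrier (polyring n)" and "p = q * h"
proof -
  let ?f = "\<lambda>i. if i \<in> {1..n} then Var i else 0"
  from assms(3) obtain h where "p = q * h" ..
  then have "subst ?f p = subst ?f q * subst ?f h"
    by (simp add: subst_mult)
  moreover have "subst ?f p = p" "subst ?f q = q"
    using assms(1,2) by (auto intro!: subst_eq_self simp: polyring_def)
  moreover have "subst ?f h \<in> carrier (polyring n)"
    using vars_subst[of ?f h] by (fastforce simp: polyring_def vars_Var split: if_splits)
  ultimately show ?thesis
    using that by metis
qed

text \<open>Translates ideal membership into divisibility in the ambient domain with infinitely many
  variables, where the results on primes apply. \<open>dvd_polyringE\<close> supplies quotients
  inside \<open>polyring n\<close>.\<close>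

lemma genideal_polyring:
  fixes q :: "'a::comm_ring_1 mpoly"
  assumes "q \<in> G" and "G \<subseteq> {p \<in> carrier (polyring n). q dvd p}"
  shows "Idl\<^bsub>polyring n\<^esub> G = {p \<in> carrier (polyring n). q dvd p}"
    and "ideal (Idl\<^bsub>polyring n\<^esub> G) (polyring n :: 'a mpoly ring)"
proof -
  interpret P: cring "polyring n :: 'a mpoly ring"
    by (rule cring_polyring)
  have G: "G \<subseteq> carrier (polyring n)"
    using assms(2) by auto
  then show I: "ideal (Idl\<^bsub>polyring n\<^esub> G) (polyring n :: 'a mpoly ring)"
    by (rule P.genideal_ideal)
  have q: "q \<in> carrier (polyring n)"
    using assms(1) G by auto
  have "Idl\<^bsub>polyring n\<^esub> G \<subseteq> PIdl\<^bsub>polyring n\<^esub> q"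
  proof (rule P.genideal_minimal[OF P.cgenideal_ideal[OF q]])
    show "G \<subseteq> PIdl\<^bsub>polyring n\<^esub> q"
    proof
      fix p assume "p \<in> G"
      then obtain h where "h \<in> carrier (polyring n)" "p = q * h"
        using dvd_polyringE[of p n q] assms(2) q by blast
      then show "p \<in> PIdl\<^bsub>polyring n\<^esub> q"
        by (auto simp: cgenideal_def polyring_def mult.commute)
    qed
  qed
  moreover have "PIdl\<^bsub>polyring n\<^esub> q \<subseteq> {p \<in> carrier (polyring n). q dvd p}"
  proof
    fix p assume "p \<in> PIdl\<^bsub>polyring n\<^esub> q"
    then obtain h where h: "h \<in> carrier (polyring n)" "p = h \<otimes>\<^bsub>polyring n\<^esub> q"
      by (auto simp: cgenideal_def)
    then have "p \<in> carrier (polyring n)"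
      using q by simp
    moreover have "p = q * h"
      using h by (simp add: polyring_def mult.commute)
    ultimately show "p \<in> {p \<in> carrier (polyring n). q dvd p}"
      by simp
  qed
  moreover have "p \<in> Idl\<^bsub>polyring n\<^esub> G" if p: "p \<in> carrier (polyring n)" "q dvd p" for p
  proof -
    obtain h where h: "h \<in> carrier (polyring n)" "p = q * h"
      by (rule dvd_polyringE[OF p(1) q p(2)])
    have "q \<in> Idl\<^bsub>polyring n\<^esub> G"
      using P.genideal_self[OF G] assms(1) by auto
    then have "q \<otimes>\<^bsub>polyring n\<^esub> h \<in> Idl\<^bsub>polyring n\<^esub> G"
      using ideal.I_r_closed[OF I] h by blast
    then show ?thesis
      by (simp add: polyring_def h)
  qed
  ultimately show "Idl\<^bsub>polyring n\<^esub> G = {p \<in> carrier (polyring n). q dvd p}"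
    by auto
qed

lemma Var_polyring: "i \<in> {1..n} \<Longrightarrow> Var i \<in> carrier (polyring n)"
  by (simp add: polyring_def vars_Var)

lemma diff_polyring:
  "p \<in> carrier (polyring n) \<Longrightarrow> q \<in> carrier (polyring n) \<Longrightarrow> p - q \<in> carrier (polyring n)"
  using vars_diff[of p q] by (auto simp: polyring_def)

lemma power_polyring: "p \<in> carrier (polyring n) \<Longrightarrow> p ^ k \<in> carrier (polyring n)"
  using vars_power[of p k] by (auto simp: polyring_def)

lemma prod_polyring:
  "(\<And>a. a \<in> A \<Longrightarrow> g a \<in> carrier (polyring n)) \<Longrightarrow> prod g A \<in> carrier (polyring n)"
  using vars_prod[of g A] by (simp add: polyring_def) (blast dest: subsetD)

lemma subst_polyring:
  assumes "p \<in> carrier (polyring n)" and "\<And>i. i \<in> {1..n} \<Longrightarrow> f i \<in> carrier (polyring m)"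
  shows "subst f p \<in> carrier (polyring m)"
  using vars_subst[of f p] assms by (fastforce simp: polyring_def)

text \<open>Hence for the full index set \<open>phi\<close> is just \<open>Var j\<close> to
  \<open>Var j ^ r\<close>; the shift comes from list positions starting at 0.\<close>

lemma nth_sorted_list_of_set_interval:
  assumes "j \<in> {1..n}"
  shows "sorted_list_of_set {1..n} ! (j - 1) = j"
proof -
  have "sorted_list_of_set {1..n} = [1..<Suc n]"
    by (metis atLeastLessThanSuc_atLeastAtMost sorted_list_of_set_range)
  then show ?thesis
    using assms by (simp del: upt_Suc)
qed

lemma phi_polyring: "p \<in> carrier (polyring n) \<Longrightarrow> phi r {1..n} p \<in> carrier (polyring n)"
  unfolding phi_def
  by (erule subst_polyring) (simp add: nth_sorted_list_of_set_interval power_polyring Var_polyring del: One_nat_def)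

lemma radical_ideal_polyring:
  assumes "ideal I (polyring n)" and "I = {p \<in> carrier (polyring n). Q p}"
    and "\<And>p k. Q (p ^ k) \<Longrightarrow> Q p"
  shows "radical_ideal I (polyring n)"
proof -
  have "p ^ 1 \<in> I" if "p \<in> I" for p
    using that by simp
  then have "radical (polyring n) I = I"
    using assms(2,3) unfolding radical_def pow_polyring by blast
  then show ?thesis
    using assms(1) by (simp add: radical_ideal_def)
qed

text \<open>The reduction shared by both shapes: it remains to find a Specht polynomial
  \<open>q\<close> dividing all others whose image under \<open>phi\<close> behaves like a
  square-free element. The intersection is kept as two divisibility conditions, each of which
  descends from powers, so no least common multiple is formed.\<close>

lemma radical_gspecht_ideal:
  fixes q :: "'a::idom mpoly"
  assumes "sum_list \<mu> = n"
    and q: "q \<in> specht_poly \<mu> ` tableaux \<mu>"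
      "specht_poly \<mu> ` tableaux \<mu> \<subseteq> {p \<in> carrier (polyring n). q dvd p}"
    and sqfree: "\<And>p k. phi r {1..n} q dvd p ^ k \<Longrightarrow> phi r {1..n} q dvd p"
  shows "radical_ideal (gspecht_ideal r n \<mu> 0 :: 'a mpoly set) (polyring n)"
proof -
  interpret P: cring "polyring n :: 'a mpoly ring"
    by (rule cring_polyring)
  let ?q = "phi r {1..n} q" and ?G = "phi r {1..n} ` specht_ideal \<mu>"
  let ?m = "\<Prod>i\<in>{1..n}. Var i" and ?M = "{\<Prod>i\<in>A. Var i | A. A \<subseteq> {1..n} \<and> card A = n - 0}"
  \<comment> \<open>For \<open>z = 0\<close> this leaves one set \<open>S\<close>, with
    \<open>X_S\<close> generated by no variables, and one squarefree monomial.\<close>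
  have full: "A \<subseteq> {1..n} \<and> card A = n - 0 \<longleftrightarrow> A = {1..n}" for A
    using card_subset_eq[of "{1..n}" A] by auto
  have "specht_ideal \<mu> = {p \<in> carrier (polyring n). q dvd p}"
    unfolding specht_ideal_def assms(1) by (rule genideal_polyring(1)[OF q])
  \<comment> \<open>\<open>?G\<close> serves as a set of generators: its members are images of
    multiples of \<open>q\<close>, and substitution preserves divisibility.\<close>
  then have G: "?q \<in> ?G" "?G \<subseteq> {p \<in> carrier (polyring n). ?q dvd p}"
    using q phi_polyring by (auto simp: phi_def intro: subst_dvd)
  have M: "?m \<in> ?M" "?M \<subseteq> {p \<in> carrier (polyring n). ?m dvd p}"
    unfolding full by (auto intro!: prod_polyring Var_polyring)
  have eq: "gspecht_ideal r n \<mu> 0 = Idl\<^bsub>polyring n\<^esub> ?G \<inter> Idl\<^bsub>polyring n\<^esub> ?M"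
    unfolding gspecht_ideal_def sqfree_ideal_def full by simp
  show ?thesis
  proof (rule radical_ideal_polyring[where Q = "\<lambda>p. ?q dvd p \<and> ?m dvd p"])
    show "ideal (gspecht_ideal r n \<mu> 0) (polyring n :: 'a mpoly ring)"
      unfolding eq by (intro P.i_intersect genideal_polyring(2)[OF G] genideal_polyring(2)[OF M])
    show "gspecht_ideal r n \<mu> 0 = {p \<in> carrier (polyring n). ?q dvd p \<and> ?m dvd p}"
      unfolding eq genideal_polyring(1)[OF G] genideal_polyring(1)[OF M] by auto
    show "?q dvd p \<and> ?m dvd p" if "?q dvd p ^ k \<and> ?m dvd p ^ k" for p k
      using that sqfree prod_prime_elem_dvd_power[of "{1..n}" Var p k]
      by (auto simp: prime_elem_Var dest: Var_dvd_Var)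
  qed
qed

section \<open>Specht polynomials of a single row and of a single column\<close>

lemma specht_poly_row: "specht_poly [n] T = 1"
proof -
  have "{(i, i'). i < i' \<and> (i, j) \<in> cells [n] \<and> (i', j) \<in> cells [n]} = {}" for j
    by (auto simp: cells_def)
  then show ?thesis
    by (simp only: specht_poly_def prod.empty prod.neutral_const)
qed

text \<open>Ensures that the row shape really contributes the generator 1.\<close>

lemma tableaux_nonempty: "tableaux \<mu> \<noteq> {}"
proof -
  have "cells \<mu> = Sigma {..<length \<mu>} (\<lambda>i. {..<\<mu> ! i})"
    by (auto simp: cells_def)
  then have "finite (cells \<mu>)" "card (cells \<mu>) = card {1..sum_list \<mu>}"
    by (simp_all add: sum_list_sum_nth atLeast0LessThan)
  then show ?thesis
    by (auto simp: tableaux_def intro: finite_same_card_bij)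
qed

lemma specht_poly_column:
  assumes "n \<ge> 1"
  shows "specht_poly (replicate n 1) T =
    (\<Prod>(i, i')\<in>{(i, i'). i < i' \<and> i' < n}. Var (T (i, 0)) - Var (T (i', 0)))"
proof -
  have cells: "cells (replicate n 1) = {..<n} \<times> {0}"
    by (auto simp: cells_def)
  then have "snd ` cells (replicate n 1) = {0}"
    using assms by (force simp: image_def)
  moreover have "{(i, i'). i < i' \<and> (i, 0) \<in> cells (replicate n 1) \<and> (i', 0) \<in> cells (replicate n 1)}
      = {(i, i'). i < i' \<and> i' < n}"
    unfolding cells by auto
  ultimately show ?thesis
    by (simp add: specht_poly_def)
qed

lemma column_tableau:
  assumes "T \<in> tableaux (replicate n 1)"
  shows "bij_betw (\<lambda>i. T (i, 0)) {..<n} {1..n}"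
proof -
  have "cells (replicate n 1) = (\<lambda>i. (i, 0)) ` {..<n}"
    by (auto simp: cells_def)
  then have "bij_betw T ((\<lambda>i. (i, 0)) ` {..<n}) {1..n}"
    using assms by (simp add: tableaux_def sum_list_replicate)
  moreover have "bij_betw (\<lambda>i. (i, 0::nat)) {..<n} ((\<lambda>i. (i, 0)) ` {..<n})"
    by (simp add: bij_betw_def inj_on_def)
  ultimately show ?thesis
    using bij_betw_trans by (fastforce simp: comp_def)
qed

text \<open>The Specht polynomial of the column filled increasingly, chosen as the distinguished
  generator. Pairs with \<open>a < b\<close> give the factors the orientation that
  \<open>linear_dvd_linear\<close> expects.\<close>

definition vandermonde :: "nat \<Rightarrow> 'a::comm_ring_1 mpoly"
  where "vandermonde n = (\<Prod>(a, b)\<in>{(a, b). 1 \<le> a \<and> a < b \<and> b \<le> n}. Var a - Var b)"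

lemma finite_ordered_pairs: "finite {(a, b). 1 \<le> a \<and> a < b \<and> b \<le> (n::nat)}"
  by (rule finite_subset[of _ "{..n} \<times> {..n}"]) auto

lemma finite_ordered_pairs_lessThan: "finite {(i, i'). i < i' \<and> i' < (n::nat)}"
  by (rule finite_subset[of _ "{..<n} \<times> {..<n}"]) auto

lemma vandermonde_in_specht_polys:
  assumes "n \<ge> 1"
  shows "vandermonde n \<in> specht_poly (replicate n 1) ` tableaux (replicate n 1)"
proof
  \<comment> \<open>Rows count from 0 and entries from 1, so row \<open>i\<close> receives
    \<open>Suc i\<close>.\<close>
  let ?T = "\<lambda>(i, j). Suc i :: nat"
  show "?T \<in> tableaux (replicate n 1)"
    unfolding tableaux_def
    by (auto simp: cells_def sum_list_replicate intro!: bij_betw_byWitness[where f' = "\<lambda>i. (i - 1, 0)"])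
  have "bij_betw (\<lambda>(i, i'). (Suc i, Suc i')) {(i, i'). i < i' \<and> i' < n}
      {(a, b). 1 \<le> a \<and> a < b \<and> b \<le> n}"
    by (rule bij_betw_byWitness[where f' = "\<lambda>(a, b). (a - 1, b - 1)"]) auto
  from prod.reindex_bij_betw[OF this, of "\<lambda>(a, b). Var a - Var b :: 'a mpoly"]
  show "vandermonde n = (specht_poly (replicate n 1) ?T :: 'a mpoly)"
    unfolding vandermonde_def specht_poly_column[OF assms] by (simp add: case_prod_unfold)
qed

text \<open>The two polynomials agree up to the sign of a permutation. Checking divisibility one
  prime factor at a time avoids computing that sign.\<close>

lemma vandermonde_dvd_specht_poly:
  assumes "n \<ge> 1" and "T \<in> tableaux (replicate n 1)"
  shows "vandermonde n dvd (specht_poly (replicate n 1) T :: 'a::idom mpoly)"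
  unfolding vandermonde_def
proof (rule prod_prime_elem_dvd[OF finite_ordered_pairs])
  let ?L = "\<lambda>(a, b). Var a - Var b :: 'a mpoly"
  show "prime_elem (?L p)" if "p \<in> {(a, b). 1 \<le> a \<and> a < b \<and> b \<le> n}" for p
    using that prime_elem_linear[of _ _ "1::'a"] by auto
  show "\<not> ?L p dvd ?L q" if "p \<in> {(a, b). 1 \<le> a \<and> a < b \<and> b \<le> n}"
      "q \<in> {(a, b). 1 \<le> a \<and> a < b \<and> b \<le> n}" "p \<noteq> q" for p q
    using that linear_dvd_linear[of "fst p" "snd p" "fst q" "snd q" "1::'a" 1] by auto
  fix p assume "p \<in> {(a, b). 1 \<le> a \<and> a < b \<and> b \<le> n}"
  then obtain a b where p: "p = (a, b)" "a \<in> {1..n}" "b \<in> {1..n}" "a \<noteq> b"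
    by auto
  have T: "(\<lambda>i. T (i, 0)) ` {..<n} = {1..n}"
    using column_tableau[OF assms(2)] by (rule bij_betw_imp_surj_on)
  obtain i where i: "i < n" "a = T (i, 0)"
    using p(2) unfolding T[symmetric] by auto
  obtain i' where i': "i' < n" "b = T (i', 0)"
    using p(3) unfolding T[symmetric] by auto
  have "?L (T (k, 0), T (k', 0)) dvd specht_poly (replicate n 1) T" if "k < k'" "k' < n" for k k'
    unfolding specht_poly_column[OF assms(1)]
    using that dvd_prodI[OF finite_ordered_pairs_lessThan, of "(k, k')" n "\<lambda>(i, i'). Var (T (i, 0)) - Var (T (i', 0))"]
    by simp
  \<comment> \<open>The entries \<open>a\<close> and \<open>b\<close> may stand in either order in
    the column; in the reversed case the factor present is the negative of the wanted one.\<close>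
  from this[of i i'] this[of i' i] show "?L p dvd specht_poly (replicate n 1) T"
    using p i i' minus_dvd_iff[of "Var b - Var a" "specht_poly (replicate n 1) T :: 'a mpoly"]
    by (cases i i' rule: linorder_cases) auto
qed

lemma specht_poly_column_polyring:
  assumes "n \<ge> 1" and "T \<in> tableaux (replicate n 1)"
  shows "specht_poly (replicate n 1) T \<in> carrier (polyring n)"
proof -
  have "T (i, 0) \<in> {1..n}" if "i < n" for i
    using column_tableau[OF assms(2)] that by (auto dest: bij_betwE)
  then show ?thesis
    unfolding specht_poly_column[OF assms(1)]
    by (intro prod_polyring) (auto intro!: diff_polyring Var_polyring)
qed

section \<open>Splitting the image of the Vandermonde product under \<open>phi\<close>\<close>

lemma phi_vandermonde:
  fixes Z :: "'a::idom set"
  assumes "finite Z" and "card Z = r" and "r > 0" and "\<And>\<zeta>. \<zeta> \<in> Z \<Longrightarrow> \<zeta> ^ r = 1"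
  shows "phi r {1..n} (vandermonde n) =
    (\<Prod>((a, b), \<zeta>)\<in>{(a, b). 1 \<le> a \<and> a < b \<and> b \<le> n} \<times> Z. Var a - Const \<zeta> * Var b)"
proof -
  let ?P = "{(a, b). 1 \<le> a \<and> a < b \<and> b \<le> n}"
  have inj: "inj_on Const Z"
    by (metis Const_def inj_onI lookup_single_eq)
  \<comment> \<open>The factorization is applied inside the polynomial ring: by injectivity of
    \<open>Const\<close>, the constants \<open>Const \<zeta>\<close> are again \<open>r\<close>
    distinct roots of unity.\<close>
  have *: "(\<Prod>\<zeta>\<in>Z. x - Const \<zeta> * y) = x ^ r - y ^ r" for x y :: "'a mpoly"
  proof -
    have "\<xi> ^ r = 1" if "\<xi> \<in> Const ` Z" for \<xi> :: "'a mpoly"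
      using that assms(4) by (auto simp flip: Const_power)
    then show ?thesis
      using prod_linear_roots_of_unity[of "Const ` Z" r x y] assms(1-3) inj
      by (simp add: card_image prod.reindex)
  qed
  have "phi r {1..n} (vandermonde n) = (\<Prod>(a, b)\<in>?P. Var a ^ r - Var b ^ r :: 'a mpoly)"
    unfolding vandermonde_def phi_def subst_prod
    by (rule prod.cong) (auto simp: subst_diff subst_Var subst_power nth_sorted_list_of_set_interval
        simp del: One_nat_def)
  also have "\<dots> = (\<Prod>p\<in>?P. \<Prod>\<zeta>\<in>Z. Var (fst p) - Const \<zeta> * Var (snd p))"
    unfolding * by (simp add: case_prod_unfold)
  also have "\<dots> = (\<Prod>((a, b), \<zeta>)\<in>?P \<times> Z. Var a - Const \<zeta> * Var b)"
    unfolding prod.cartesian_product by (simp add: case_prod_unfold)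
  finally show ?thesis .
qed

lemma phi_vandermonde_dvd_power:
  fixes Z :: "'a::idom set"
  assumes Z: "finite Z" "card Z = r" "r > 0" "\<And>\<zeta>. \<zeta> \<in> Z \<Longrightarrow> \<zeta> ^ r = 1"
    and "phi r {1..n} (vandermonde n :: 'a mpoly) dvd p ^ k"
  shows "phi r {1..n} (vandermonde n) dvd p"
proof -
  let ?A = "{(a, b). 1 \<le> a \<and> a < b \<and> b \<le> n} \<times> Z"
  let ?L = "\<lambda>((a, b), \<zeta>). Var a - Const \<zeta> * Var b :: 'a mpoly"
  \<comment> \<open>A nonzero coefficient is required by \<open>linear_dvd_linear\<close>, which
    then makes the forms for distinct triples pairwise non-dividing.\<close>
  have nz: "0 \<notin> Z"
    using Z(3,4) by (force simp: zero_power)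
  have eq: "phi r {1..n} (vandermonde n) = prod ?L ?A"
    by (rule phi_vandermonde) (use Z in auto)
  have "prod ?L ?A dvd p"
  proof (rule prod_prime_elem_dvd_power)
    show "finite ?A"
      using finite_ordered_pairs Z(1) by blast
    show "prime_elem (?L t)" if "t \<in> ?A" for t
      using that by (auto intro: prime_elem_linear)
    show "\<not> ?L s dvd ?L t" if st: "s \<in> ?A" "t \<in> ?A" "s \<noteq> t" for s t
    proof
      assume dvd: "?L s dvd ?L t"
      obtain a b c a' b' c' where "s = ((a, b), c)" "t = ((a', b'), c')"
        by (metis surj_pair)
      then show False
        using st dvd nz linear_dvd_linear[of a b a' b' c c'] by auto
    qed
    show "prod ?L ?A dvd p ^ k"
      using assms(5) unfolding eq .
  qed
  then show ?thesis
    unfolding eq .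
qed

theorem proposition5p5:
  fixes n r :: nat
  assumes "infinite (UNIV :: 'a::field set)"
    and "card {\<zeta>::'a. \<zeta> ^ r = 1} = r"
    and "n \<ge> 1" and "r \<ge> 2"
  shows "radical_ideal (gspecht_ideal r n (replicate n 1) 0 :: 'a mpoly set) (polyring n) \<and>
    radical_ideal (gspecht_ideal r n [n] 0 :: 'a mpoly set) (polyring n)"
proof
  let ?Z = "{\<zeta>::'a. \<zeta> ^ r = 1}"
  \<comment> \<open>Infinite sets have \<open>card\<close> 0, so a cardinality of at least 2 forces
    finiteness.\<close>
  have "finite ?Z"
    using assms(2,4) by (intro card_ge_0_finite) simp
  show "radical_ideal (gspecht_ideal r n (replicate n 1) 0 :: 'a mpoly set) (polyring n)"
  proof (rule radical_gspecht_ideal[where q = "vandermonde n"])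
    show "vandermonde n \<in> specht_poly (replicate n 1) ` tableaux (replicate n 1)"
      by (rule vandermonde_in_specht_polys[OF assms(3)])
    show "specht_poly (replicate n 1) ` tableaux (replicate n 1) \<subseteq>
        {p \<in> carrier (polyring n). (vandermonde n :: 'a mpoly) dvd p}"
      by (intro image_subsetI CollectI conjI vandermonde_dvd_specht_poly
          specht_poly_column_polyring assms(3))
    show "phi r {1..n} (vandermonde n) dvd p" if "phi r {1..n} (vandermonde n) dvd p ^ k"
      for p :: "'a mpoly" and k
      by (rule phi_vandermonde_dvd_power[OF \<open>finite ?Z\<close> assms(2) _ _ that])
         (use assms(4) in simp_all)
  qed (simp add: sum_list_replicate)
  show "radical_ideal (gspecht_ideal r n [n] 0 :: 'a mpoly set) (polyring n)"
  \<comment> \<open>\<open>phi\<close> maps 1 to 1, which divides everything, so only the squarefree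
    monomial constrains the ideal.\<close>
  proof (rule radical_gspecht_ideal[where q = 1])
    show "1 \<in> (specht_poly [n] :: _ \<Rightarrow> 'a mpoly) ` tableaux [n]"
      using tableaux_nonempty by (auto simp: specht_poly_row)
    show "specht_poly [n] ` tableaux [n] \<subseteq> {p \<in> carrier (polyring n). (1 :: 'a mpoly) dvd p}"
      by (auto simp: specht_poly_row polyring_def)
  qed (simp_all add: phi_def)
qed

end
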